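(* There is a function $f:(0,1)\to\mathbb R$ with $f(\tau)>0$ for all $0<\tau<1$ such that the following holds. For every $\tau\in(0,1)$ and all pure states $|\psi_{x_0}\rangle,|\psi_{x_1}\rangle$ with $|\langle\psi_{x_0}|\psi_{x_1}\rangle|=\tau$, there exists $c>0$ such that, in the state-comparison game with wrong-answer penalty $c$ played with $|\psi_{x_0}\rangle,|\psi_{x_1}\rangle$, $$p_s\le p_{\max}-f(\tau),$$ where $p_{\max}$ is the maximal expected payoff over all measurement strategies and $p_s$ is the supremum of the expected payoffs over separable measurement strategies.
   Context: **State-comparison game.** Fix pure states $|\psi_{x_0}\rangle,|\psi_{x_1}\rangle$ in a finite-dimensional Hilbert space $\mathcal H$ and $c>0$. Bob receives a state in $\mathcal H\otimes\mathcal H$ that is one of the four product states $|\psi_\alpha\rangle|\psi_\beta\rangle$, $\alpha,\beta\in\{x_0,x_1\}$, each with probability $1/4$. He outputs $b\in\{0,1,?\}$, where $0$ is the guess that the two factors are equal ($\alpha=\beta$), $1$ the guess that they are different ($\alpha\ne\beta$), and $?$ means "don't know". The payoff is $1$ if the guess is correct, $-c$ if it is incorrect, and $0$ if Bob answers $?$. **Strategies.** A measurement strategy is a POVM $(E_0,E_1,E_?)$ on $\mathcal H\otimes\mathcal H$ whose outcome is Bob's answer. It is *separable* if each of its elements is a finite sum of tensor products $F^0\otimes F^1$ of positive semidefinite operators, $F^0$ acting on the first factor and $F^1$ on the second. *)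

theory Defs
  imports Complex_Main "Jordan_Normal_Form.Conjugate" "Jordan_Normal_Form.Matrix"
begin

text \<open>
  The finite-dimensional Hilbert space is represented as the space of complex vectors of
  dimension n, with the dimension n a term so that one can quantify over it.
  The library's complex scalar product is conjugate-linear in its second argument, so
  the physicists' inner product of u and v is written with v on the left and u on the right.
\<close>

text \<open>
  The tensor product of spaces of dimensions m and n is the space of dimension m * n, where
  the basis vector number i * n + j (i < m, j < n) stands for the tensor product of the
  i-th and the j-th basis vector. Both definitions below are Kronecker products for this
  identification.
\<close>

definition tensor_vec :: "complex vec \<Rightarrow> complex vec \<Rightarrow> complex vec" (infixl \<open>\<otimes>\<^sub>v\<close> 71) where
  "u \<otimes>\<^sub>v v = vec (dim_vec u * dim_vec v)
     (\<lambda>i. u $ (i div dim_vec v) * v $ (i mod dim_vec v))"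

definition tensor_mat :: "complex mat \<Rightarrow> complex mat \<Rightarrow> complex mat" (infixl \<open>\<otimes>\<^sub>m\<close> 71) where
  "A \<otimes>\<^sub>m B = mat (dim_row A * dim_row B) (dim_col A * dim_col B)
     (\<lambda>(i, j). A $$ (i div dim_row B, j div dim_col B) * B $$ (i mod dim_row B, j mod dim_col B))"

text \<open>In the order on complex numbers, 0 \<le> z says that z is real and nonnegative.\<close>

definition psd :: "nat \<Rightarrow> complex mat \<Rightarrow> bool" where
  "psd d A \<longleftrightarrow> A \<in> carrier_mat d d \<and> (\<forall>v \<in> carrier_vec d. 0 \<le> (A *\<^sub>v v) \<bullet>c v)"

definition pure_state :: "nat \<Rightarrow> complex vec \<Rightarrow> bool" where
  "pure_state n v \<longleftrightarrow> v \<in> carrier_vec n \<and> v \<bullet>c v = 1"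

datatype label = X0 | X1

datatype answer = Equal | Different | DontKnow

definition povm :: "nat \<Rightarrow> (answer \<Rightarrow> complex mat) \<Rightarrow> bool" where
  "povm d E \<longleftrightarrow> (\<forall>b. psd d (E b)) \<and> E Equal + E Different + E DontKnow = 1\<^sub>m d"

definition strategy :: "nat \<Rightarrow> (answer \<Rightarrow> complex mat) \<Rightarrow> bool" where
  "strategy n E \<longleftrightarrow> povm (n * n) E"

definition separable_op :: "nat \<Rightarrow> complex mat \<Rightarrow> bool" where
  "separable_op n A \<longleftrightarrow>
     (\<exists>Fs. (\<forall>(F0, F1) \<in> set Fs. psd n F0 \<and> psd n F1) \<and>
           A = foldr (\<lambda>(F0, F1) S. F0 \<otimes>\<^sub>m F1 + S) Fs (0\<^sub>m (n * n) (n * n)))"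

definition separable_strategy :: "nat \<Rightarrow> (answer \<Rightarrow> complex mat) \<Rightarrow> bool" where
  "separable_strategy n E \<longleftrightarrow> strategy n E \<and> (\<forall>b. separable_op n (E b))"

fun payoff :: "real \<Rightarrow> label \<Rightarrow> label \<Rightarrow> answer \<Rightarrow> real" where
  "payoff c \<alpha> \<beta> Equal = (if \<alpha> = \<beta> then 1 else - c)"
| "payoff c \<alpha> \<beta> Different = (if \<alpha> \<noteq> \<beta> then 1 else - c)"
| "payoff c \<alpha> \<beta> DontKnow = 0"

definition outcome_prob :: "complex mat \<Rightarrow> complex vec \<Rightarrow> real" where
  "outcome_prob A v = Re ((A *\<^sub>v v) \<bullet>c v)"

definition expected_payoff ::
    "real \<Rightarrow> (label \<Rightarrow> complex vec) \<Rightarrow> (answer \<Rightarrow> complex mat) \<Rightarrow> real" where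
  "expected_payoff c \<psi> E =
     (\<Sum>\<alpha>\<in>{X0, X1}. \<Sum>\<beta>\<in>{X0, X1}. 1 / 4 *
        (\<Sum>b\<in>{Equal, Different, DontKnow}.
           outcome_prob (E b) (\<psi> \<alpha> \<otimes>\<^sub>v \<psi> \<beta>) * payoff c \<alpha> \<beta> b))"

text \<open>
  The first value below is a maximum, not just a supremum: GREATEST is unspecified unless the
  maximum is attained. The second is a supremum over a nonempty set that is bounded above.
\<close>

definition p_max :: "nat \<Rightarrow> real \<Rightarrow> (label \<Rightarrow> complex vec) \<Rightarrow> real" where
  "p_max n c \<psi> = (GREATEST p. p \<in> expected_payoff c \<psi> ` {E. strategy n E})"

definition p_sep :: "nat \<Rightarrow> real \<Rightarrow> (label \<Rightarrow> complex vec) \<Rightarrow> real" where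
  "p_sep n c \<psi> = Sup (expected_payoff c \<psi> ` {E. separable_strategy n E})"

end

theory Submission
  imports Defs
begin

text \<open>
  After a change of phase, the two states a, b have inner product \<open>\<tau>\<close>. Both optimisation problems
  are solved by a dual witness: an operator K whose expectation dominates, in every outcome, the
  payoff form of that outcome, so that the payoff is at most tr K. For general measurements this
  is needed for all vectors, and after splitting each pair of product states into its sum and its
  difference it leads to the exact optimum, which tends to \<open>1 - \<tau>\<close> from above as c grows. For
  separable measurements it is needed on product vectors only, where a multiple of the
  projection onto \<open>(a - b) \<otimes> (a - b)\<close> suffices: the payoff is at most \<open>(1 + \<delta>) (1 - \<tau>)\<^sup>2\<close>
  as soon as \<open>c \<ge> 2 (1 + 1 / \<delta>)\<close>. Taking \<open>\<delta> = \<tau>\<close> leaves the gap \<open>\<tau>\<^sup>2 (1 - \<tau>)\<close>.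
\<close>

section \<open>Sesquilinear forms\<close>

lemma cscalar_prod_add_left:
  fixes x y z :: "complex vec"
  assumes "x \<in> carrier_vec d" "y \<in> carrier_vec d" "z \<in> carrier_vec d"
  shows "(x + y) \<bullet>c z = x \<bullet>c z + y \<bullet>c z"
  using assms by (simp add: scalar_prod_def sum.distrib distrib_right)

lemma cscalar_prod_minus_left:
  fixes x y z :: "complex vec"
  assumes "x \<in> carrier_vec d" "y \<in> carrier_vec d" "z \<in> carrier_vec d"
  shows "(x - y) \<bullet>c z = x \<bullet>c z - y \<bullet>c z"
  using assms by (simp add: scalar_prod_def sum_subtractf left_diff_distrib)

lemma cscalar_prod_smult_left:
  fixes x z :: "complex vec"
  assumes "x \<in> carrier_vec d" "z \<in> carrier_vec d"
  shows "(k \<cdot>\<^sub>v x) \<bullet>c z = k * (x \<bullet>c z)"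
  using assms by (simp add: scalar_prod_def sum_distrib_left mult.assoc)

lemma cscalar_prod_add_right:
  fixes x y z :: "complex vec"
  assumes "x \<in> carrier_vec d" "y \<in> carrier_vec d" "z \<in> carrier_vec d"
  shows "z \<bullet>c (x + y) = z \<bullet>c x + z \<bullet>c y"
  using assms by (simp add: scalar_prod_def sum.distrib distrib_left)

lemma cscalar_prod_minus_right:
  fixes x y z :: "complex vec"
  assumes "x \<in> carrier_vec d" "y \<in> carrier_vec d" "z \<in> carrier_vec d"
  shows "z \<bullet>c (x - y) = z \<bullet>c x - z \<bullet>c y"
  using assms by (simp add: scalar_prod_def sum_subtractf right_diff_distrib)

lemma cscalar_prod_smult_right:
  fixes x z :: "complex vec"
  assumes "x \<in> carrier_vec d" "z \<in> carrier_vec d"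
  shows "z \<bullet>c (k \<cdot>\<^sub>v x) = cnj k * (z \<bullet>c x)"
  using assms by (simp add: scalar_prod_def sum_distrib_left mult_ac)

lemmas cscalar_prod_simps =
  cscalar_prod_add_left cscalar_prod_minus_left cscalar_prod_smult_left
  cscalar_prod_add_right cscalar_prod_minus_right cscalar_prod_smult_right

lemma cscalar_prod_cnj:
  fixes x y :: "complex vec"
  assumes "x \<in> carrier_vec d" "y \<in> carrier_vec d"
  shows "cnj (x \<bullet>c y) = y \<bullet>c x"
  using assms by (simp add: scalar_prod_def mult.commute)

lemma cscalar_prod_self_nonneg:
  fixes x :: "complex vec"
  shows "0 \<le> x \<bullet>c x"
  unfolding scalar_prod_def by (auto intro!: sum_nonneg simp: less_eq_complex_def)

text \<open>Subtracting from \<open>v\<close> its component along one \<open>x j\<close> lowers the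
  squared norm by exactly that summand and leaves the other coefficients unchanged, which drives the
  induction. The system is orthogonal but not normalised: \<open>g i\<close> is the squared norm, so
  the vectors built later from product states need no rescaling.\<close>

lemma bessel_inequality:
  fixes x :: "'i \<Rightarrow> complex vec" and g :: "'i \<Rightarrow> real"
  assumes "finite I" "v \<in> carrier_vec d" "\<And>i. i \<in> I \<Longrightarrow> x i \<in> carrier_vec d"
    and "\<And>i. i \<in> I \<Longrightarrow> x i \<bullet>c x i = complex_of_real (g i)" "\<And>i. i \<in> I \<Longrightarrow> 0 < g i"
    and "\<And>i j. i \<in> I \<Longrightarrow> j \<in> I \<Longrightarrow> i \<noteq> j \<Longrightarrow> x i \<bullet>c x j = 0"
  shows "(\<Sum>i\<in>I. (cmod (v \<bullet>c x i))\<^sup>2 / g i) \<le> Re (v \<bullet>c v)"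
  using assms
proof (induction I arbitrary: v rule: finite_induct)
  case empty
  then show ?case using cscalar_prod_self_nonneg[of v] by (simp add: less_eq_complex_def)
next
  case (insert j I)
  define k where "k = v \<bullet>c x j"
  define l where "l = k / complex_of_real (g j)"
  define v' where "v' = v - l \<cdot>\<^sub>v x j"
  have c: "v \<in> carrier_vec d" "x j \<in> carrier_vec d" "v' \<in> carrier_vec d"
    using insert.prems by (auto simp: v'_def)
  have kk: "x j \<bullet>c v = cnj k" unfolding k_def using cscalar_prod_cnj[OF c(1,2)] by simp
  have n: "x j \<bullet>c x j = complex_of_real (g j)" "g j > 0" using insert.prems by blast+
  have "v' \<bullet>c v' = v \<bullet>c v - (k * cnj k) / complex_of_real (g j)"
    unfolding v'_def using c(1,2) n kk k_def[symmetric]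
    by (simp add: cscalar_prod_simps[where d = d] l_def)
  also have "\<dots> = v \<bullet>c v - complex_of_real ((cmod k)\<^sup>2 / g j)"
    by (simp only: complex_norm_square[symmetric] of_real_divide)
  finally have sq: "Re (v' \<bullet>c v') = Re (v \<bullet>c v) - (cmod k)\<^sup>2 / g j"
    by (simp only: minus_complex.sel Re_complex_of_real)
  have "v' \<bullet>c x i = v \<bullet>c x i" if "i \<in> I" for i
  proof -
    have "x j \<bullet>c x i = 0" using insert.prems(5)[of j i] insert.hyps that by auto
    moreover have "x i \<in> carrier_vec d" using insert.prems that by auto
    ultimately show ?thesis
      unfolding v'_def using c(1,2) by (simp add: cscalar_prod_simps[where d = d])
  qed
  moreover have "(\<Sum>i\<in>I. (cmod (v' \<bullet>c x i))\<^sup>2 / g i) \<le> Re (v' \<bullet>c v')"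
    using insert.prems c by (intro insert.IH) auto
  ultimately have "(\<Sum>i\<in>I. (cmod (v \<bullet>c x i))\<^sup>2 / g i) \<le> Re (v' \<bullet>c v')" by simp
  then show ?case using insert.hyps sq by (simp add: k_def)
qed

section \<open>Outcome probabilities as quadratic forms\<close>

text \<open>What matters about the cross term \<open>X\<close> is that it is the same for all real
  \<open>k\<close>; its formula stays hidden behind the quantifier.\<close>

lemma outcome_prob_add_smult:
  assumes A: "A \<in> carrier_mat d d" and x: "x \<in> carrier_vec d" and y: "y \<in> carrier_vec d"
  shows "\<exists>X. \<forall>k::real. outcome_prob A (x + complex_of_real k \<cdot>\<^sub>v y)
    = outcome_prob A x + k * X + k\<^sup>2 * outcome_prob A y"
proof (intro exI allI)
  fix k :: real
  have c: "A *\<^sub>v x \<in> carrier_vec d" "A *\<^sub>v y \<in> carrier_vec d"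
    using A x y by auto
  have m: "A *\<^sub>v (x + complex_of_real k \<cdot>\<^sub>v y) = A *\<^sub>v x + complex_of_real k \<cdot>\<^sub>v (A *\<^sub>v y)"
    using A x y by (simp add: mult_add_distrib_mat_vec[of _ d d] mult_mat_vec[of _ d d])
  show "outcome_prob A (x + complex_of_real k \<cdot>\<^sub>v y) = outcome_prob A x
    + k * (Re ((A *\<^sub>v x) \<bullet>c y) + Re ((A *\<^sub>v y) \<bullet>c x)) + k\<^sup>2 * outcome_prob A y"
    unfolding outcome_prob_def m using c x y
    by (simp add: cscalar_prod_simps[where d = d] algebra_simps power2_eq_square)
qed

lemma outcome_prob_minus:
  assumes A: "A \<in> carrier_mat d d" and x: "x \<in> carrier_vec d" and y: "y \<in> carrier_vec d"
  obtains X where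
    "\<And>k::real. outcome_prob A (x - complex_of_real k \<cdot>\<^sub>v y)
      = outcome_prob A x - k * X + k\<^sup>2 * outcome_prob A y"
    "outcome_prob A (x - y) = outcome_prob A x - X + outcome_prob A y"
    "outcome_prob A (x + y) = outcome_prob A x + X + outcome_prob A y"
proof -
  obtain X where X: "\<And>k::real. outcome_prob A (x + complex_of_real k \<cdot>\<^sub>v y)
    = outcome_prob A x + k * X + k\<^sup>2 * outcome_prob A y"
    using outcome_prob_add_smult[OF assms] by blast
  have 1: "x - complex_of_real k \<cdot>\<^sub>v y = x + complex_of_real (- k) \<cdot>\<^sub>v y" for k
    using x y by auto
  have 2: "x - y = x + complex_of_real (- 1) \<cdot>\<^sub>v y" "x + y = x + complex_of_real 1 \<cdot>\<^sub>v y"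
    using x y by auto
  show thesis
    by (rule that[of X]) (unfold 1 2 X, simp_all)
qed

lemma outcome_prob_smult:
  assumes "A \<in> carrier_mat d d" "x \<in> carrier_vec d"
  shows "outcome_prob A (k \<cdot>\<^sub>v x) = (cmod k)\<^sup>2 * outcome_prob A x"
proof -
  have "A *\<^sub>v x \<in> carrier_vec d" using assms by auto
  then have "(A *\<^sub>v (k \<cdot>\<^sub>v x)) \<bullet>c (k \<cdot>\<^sub>v x) = complex_of_real ((cmod k)\<^sup>2) * ((A *\<^sub>v x) \<bullet>c x)"
    using assms complex_norm_square[of k]
    by (simp add: mult_mat_vec[of _ d d] cscalar_prod_simps[where d = d])
  then show ?thesis
    unfolding outcome_prob_def by simp
qed

lemma outcome_prob_add_mat:
  assumes "A \<in> carrier_mat d d" "B \<in> carrier_mat d d" "x \<in> carrier_vec d"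
  shows "outcome_prob (A + B) x = outcome_prob A x + outcome_prob B x"
proof -
  have "A *\<^sub>v x \<in> carrier_vec d" "B *\<^sub>v x \<in> carrier_vec d" using assms by auto
  then show ?thesis
    unfolding outcome_prob_def using assms
    by (simp add: add_mult_distrib_mat_vec[of _ d d] cscalar_prod_simps[where d = d])
qed

lemma outcome_prob_zero [simp]:
  "x \<in> carrier_vec d \<Longrightarrow> outcome_prob (0\<^sub>m d d) x = 0"
  unfolding outcome_prob_def by (auto simp: scalar_prod_def)

lemma psd_carrier: "psd d A \<Longrightarrow> A \<in> carrier_mat d d"
  by (simp add: psd_def)

lemma psd_outcome_prob_nonneg: "psd d A \<Longrightarrow> x \<in> carrier_vec d \<Longrightarrow> 0 \<le> outcome_prob A x"
  by (auto simp: psd_def outcome_prob_def less_eq_complex_def)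

lemma psd_of_real:
  assumes "psd d A" "x \<in> carrier_vec d"
  shows "(A *\<^sub>v x) \<bullet>c x = complex_of_real (outcome_prob A x)"
  using assms by (auto simp: psd_def outcome_prob_def less_eq_complex_def complex_eq_iff)

lemma psd_zero: "psd d (0\<^sub>m d d)"
  by (auto simp: psd_def scalar_prod_def)

lemma psd_one: "psd d (1\<^sub>m d)"
  by (auto simp: psd_def cscalar_prod_self_nonneg)

text \<open>The cross terms cancel. This trades two product states with the same correct answer for
  their sum and difference.\<close>

lemma outcome_prob_parallelogram:
  assumes "A \<in> carrier_mat d d" "x \<in> carrier_vec d" "y \<in> carrier_vec d"
  shows "outcome_prob A x + outcome_prob A y
    = (outcome_prob A (x + y) + outcome_prob A (x - y)) / 2"
  by (rule outcome_prob_minus[OF assms]) simp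

text \<open>Multiplied by \<open>c - 1\<close>, the two sides differ by the outcome probability of \<open>x - c y\<close>.\<close>

lemma outcome_prob_diff_bound:
  assumes A: "psd d A" and x: "x \<in> carrier_vec d" and y: "y \<in> carrier_vec d" and c: "c > 1"
  shows "outcome_prob A x - c * outcome_prob A y \<le> c / (c - 1) * outcome_prob A (x - y)"
proof -
  obtain X where X: "\<And>k::real. outcome_prob A (x - complex_of_real k \<cdot>\<^sub>v y)
      = outcome_prob A x - k * X + k\<^sup>2 * outcome_prob A y"
    "outcome_prob A (x - y) = outcome_prob A x - X + outcome_prob A y"
    using outcome_prob_minus[OF psd_carrier[OF A] x y] by metis
  have "x - complex_of_real c \<cdot>\<^sub>v y \<in> carrier_vec d" using x y by auto
  then have "0 \<le> outcome_prob A (x - complex_of_real c \<cdot>\<^sub>v y)"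
    using psd_outcome_prob_nonneg[OF A] by blast
  then have "0 \<le> outcome_prob A x - c * X + c\<^sup>2 * outcome_prob A y" by (simp only: X)
  then have "(c - 1) * (outcome_prob A x - c * outcome_prob A y) \<le> c * outcome_prob A (x - y)"
    unfolding X(2) by (simp add: algebra_simps power2_eq_square)
  then show ?thesis using c by (simp add: field_simps)
qed

text \<open>Reverse triangle inequality for the seminorm whose square is the outcome probability.
  The bound \<open>X \<le> 2 * p * q\<close> on the cross term is Cauchy-Schwarz, read off from the
  nonnegativity of a quadratic in \<open>k\<close>, with the degenerate cases treated
  separately.\<close>

lemma outcome_prob_minus_ge:
  assumes A: "psd d A" and x: "x \<in> carrier_vec d" and y: "y \<in> carrier_vec d"
  shows "(sqrt (outcome_prob A x) - sqrt (outcome_prob A y))\<^sup>2 \<le> outcome_prob A (x - y)"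
proof -
  define p q where "p = sqrt (outcome_prob A x)" and "q = sqrt (outcome_prob A y)"
  have pq: "outcome_prob A x = p\<^sup>2" "outcome_prob A y = q\<^sup>2" "p \<ge> 0" "q \<ge> 0"
    using psd_outcome_prob_nonneg[OF A] x y by (auto simp: p_def q_def)
  obtain X where X: "\<And>k::real. outcome_prob A (x - complex_of_real k \<cdot>\<^sub>v y)
      = outcome_prob A x - k * X + k\<^sup>2 * outcome_prob A y"
    "outcome_prob A (x - y) = outcome_prob A x - X + outcome_prob A y"
    using outcome_prob_minus[OF psd_carrier[OF A] x y] by metis
  have nn: "0 \<le> p\<^sup>2 - k * X + k\<^sup>2 * q\<^sup>2" for k
  proof -
    have "x - complex_of_real k \<cdot>\<^sub>v y \<in> carrier_vec d" using x y by auto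
    then have "0 \<le> outcome_prob A (x - complex_of_real k \<cdot>\<^sub>v y)"
      using psd_outcome_prob_nonneg[OF A] by blast
    then show ?thesis by (simp only: X pq)
  qed
  have "X \<le> 2 * p * q"
  proof (cases "q = 0")
    case True
    show ?thesis
    proof (rule ccontr)
      assume "\<not> X \<le> 2 * p * q"
      then have "X > 0" using True by simp
      \<comment> \<open>For \<open>q = 0\<close> the quadratic is affine in \<open>k\<close>, and
        this \<open>k\<close> gives it the value -1.\<close>
      then show False using nn[of "(p\<^sup>2 + 1) / X"] True by simp
    qed
  next
    case False
    then have q: "q > 0" using pq by simp
    show ?thesis
    proof (cases "p = 0")
      case True
      have "X \<le> 0"
      proof (rule ccontr)
        assume "\<not> X \<le> 0"
        then have "X > 0" by simp
        \<comment> \<open>The minimiser of \<open>k\<^sup>2 * q\<^sup>2 - k * X\<close>, whose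
          minimum is negative.\<close>
        define t where "t = X / (2 * q\<^sup>2)"
        have "t > 0" "X = 2 * t * q\<^sup>2" using \<open>X > 0\<close> q by (simp_all add: t_def)
        then have "t * X = 2 * (t\<^sup>2 * q\<^sup>2)" "t\<^sup>2 * q\<^sup>2 > 0" using q
          by (simp_all add: power2_eq_square mult_ac)
        moreover have "p\<^sup>2 = 0" using True by simp
        ultimately show False using nn[of t] by linarith
      qed
      then show ?thesis using True by simp
    next
      case False
      then have "p > 0" using pq by simp
      \<comment> \<open>At \<open>k = p / q\<close> both square terms equal
        \<open>p\<^sup>2\<close>, which gives the sharp bound on \<open>X\<close>.\<close>
      have "0 \<le> p\<^sup>2 - p / q * X + (p / q)\<^sup>2 * q\<^sup>2" by (rule nn)
      then have "p / q * X \<le> p / q * (2 * p * q)"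
        using q by (simp add: power_divide power2_eq_square)
      moreover have "p / q > 0" using \<open>p > 0\<close> q by simp
      ultimately show ?thesis using mult_le_cancel_left_pos by blast
    qed
  qed
  then show ?thesis
    unfolding X(2) p_def[symmetric] q_def[symmetric] unfolding pq by (simp add: power2_diff)
qed

section \<open>Tensor products\<close>

lemma tensor_vec_carrier [simp]:
  "x \<in> carrier_vec m \<Longrightarrow> y \<in> carrier_vec n \<Longrightarrow> x \<otimes>\<^sub>v y \<in> carrier_vec (m * n)"
  by (auto simp: tensor_vec_def)

lemma tensor_mat_carrier [simp]:
  "A \<in> carrier_mat m m \<Longrightarrow> B \<in> carrier_mat n n \<Longrightarrow> A \<otimes>\<^sub>m B \<in> carrier_mat (m * n) (m * n)"
  by (auto simp: tensor_mat_def)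

lemma div_mod_less:
  fixes i m n :: nat
  assumes "i < m * n"
  shows "i div n < m" "i mod n < n"
proof -
  have "n > 0" using assms by (cases n) auto
  then show "i div n < m" "i mod n < n"
    using assms by (auto simp: less_mult_imp_div_less)
qed

text \<open>The map to quotient and remainder is a bijection with inverse \<open>i * n + j\<close>.
  All sums over Kronecker indices are split by this lemma.\<close>

lemma sum_div_mod:
  fixes f :: "nat \<Rightarrow> nat \<Rightarrow> 'a::comm_monoid_add"
  shows "(\<Sum>i<m * n. f (i div n) (i mod n)) = (\<Sum>i<m. \<Sum>j<n. f i j)"
proof -
  have "(\<Sum>i<m * n. f (i div n) (i mod n)) = (\<Sum>(i, j)\<in>{..<m} \<times> {..<n}. f i j)"
  proof (rule sum.reindex_bij_witness[where j = "\<lambda>i. (i div n, i mod n)" and i = "\<lambda>(i, j). i * n + j"])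
    fix b :: "nat \<times> nat"
    assume "b \<in> {..<m} \<times> {..<n}"
    then obtain i j where b: "b = (i, j)" "i < m" "j < n" by auto
    then have "i * n + j < (i + 1) * n" "(i + 1) * n \<le> m * n"
      by (simp, intro mult_le_mono1, simp)
    then show "(case b of (i, j) \<Rightarrow> i * n + j) \<in> {..<m * n}" using b by simp
  qed (auto simp: div_mod_less)
  then show ?thesis by (simp add: sum.cartesian_product)
qed

lemma cscalar_prod_tensor:
  assumes "x \<in> carrier_vec m" "y \<in> carrier_vec n" "x' \<in> carrier_vec m" "y' \<in> carrier_vec n"
  shows "(x \<otimes>\<^sub>v y) \<bullet>c (x' \<otimes>\<^sub>v y') = (x \<bullet>c x') * (y \<bullet>c y')"
proof -
  have "(x \<otimes>\<^sub>v y) \<bullet>c (x' \<otimes>\<^sub>v y')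
    = (\<Sum>i<m * n. (x $ (i div n) * cnj (x' $ (i div n))) * (y $ (i mod n) * cnj (y' $ (i mod n))))"
    using assms by (auto simp: scalar_prod_def tensor_vec_def lessThan_atLeast0 mult_ac
        intro!: sum.cong)
  also have "\<dots> = (\<Sum>i<m. \<Sum>j<n. (x $ i * cnj (x' $ i)) * (y $ j * cnj (y' $ j)))"
    by (rule sum_div_mod)
  also have "\<dots> = (x \<bullet>c x') * (y \<bullet>c y')"
    using assms by (simp add: scalar_prod_def lessThan_atLeast0 sum_product)
  finally show ?thesis .
qed

lemma tensor_mat_mult_vec:
  assumes "A \<in> carrier_mat m m" "B \<in> carrier_mat n n" "x \<in> carrier_vec m" "y \<in> carrier_vec n"
  shows "(A \<otimes>\<^sub>m B) *\<^sub>v (x \<otimes>\<^sub>v y) = (A *\<^sub>v x) \<otimes>\<^sub>v (B *\<^sub>v y)"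
proof (rule eq_vecI)
  show "dim_vec ((A \<otimes>\<^sub>m B) *\<^sub>v (x \<otimes>\<^sub>v y)) = dim_vec ((A *\<^sub>v x) \<otimes>\<^sub>v (B *\<^sub>v y))"
    using assms by (auto simp: tensor_mat_def tensor_vec_def)
next
  fix i
  assume "i < dim_vec ((A *\<^sub>v x) \<otimes>\<^sub>v (B *\<^sub>v y))"
  then have i: "i < m * n" using assms by (auto simp: tensor_vec_def)
  note d = div_mod_less[OF i]
  have "((A \<otimes>\<^sub>m B) *\<^sub>v (x \<otimes>\<^sub>v y)) $ i
    = (\<Sum>j<m * n. (A $$ (i div n, j div n) * x $ (j div n)) * (B $$ (i mod n, j mod n) * y $ (j mod n)))"
    using assms i by (auto simp: scalar_prod_def tensor_vec_def tensor_mat_def lessThan_atLeast0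
        mult_ac intro!: sum.cong)
  also have "\<dots> = (\<Sum>k<m. \<Sum>l<n. (A $$ (i div n, k) * x $ k) * (B $$ (i mod n, l) * y $ l))"
    by (rule sum_div_mod)
  also have "\<dots> = ((A *\<^sub>v x) \<otimes>\<^sub>v (B *\<^sub>v y)) $ i"
    using assms i d
    by (simp add: scalar_prod_def tensor_vec_def lessThan_atLeast0 sum_product)
  finally show "((A \<otimes>\<^sub>m B) *\<^sub>v (x \<otimes>\<^sub>v y)) $ i = ((A *\<^sub>v x) \<otimes>\<^sub>v (B *\<^sub>v y)) $ i" .
qed

text \<open>The form factorises over the complex numbers; its real part factorises too because
  positivity makes both factors real.\<close>

lemma outcome_prob_tensor:
  assumes F: "psd m F" and G: "psd n G" and x: "x \<in> carrier_vec m" and y: "y \<in> carrier_vec n"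
  shows "outcome_prob (F \<otimes>\<^sub>m G) (x \<otimes>\<^sub>v y) = outcome_prob F x * outcome_prob G y"
proof -
  have c: "F \<in> carrier_mat m m" "G \<in> carrier_mat n n"
    using F G by (auto simp: psd_carrier)
  have "F *\<^sub>v x \<in> carrier_vec m" "G *\<^sub>v y \<in> carrier_vec n" using c x y by auto
  then have "((F \<otimes>\<^sub>m G) *\<^sub>v (x \<otimes>\<^sub>v y)) \<bullet>c (x \<otimes>\<^sub>v y)
    = complex_of_real (outcome_prob F x) * complex_of_real (outcome_prob G y)"
    using c x y by (simp add: tensor_mat_mult_vec cscalar_prod_tensor[of _ m _ n]
        psd_of_real[OF F] psd_of_real[OF G])
  then show ?thesis unfolding outcome_prob_def[of "F \<otimes>\<^sub>m G"] by simp
qed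

lemma tensor_vec_smult:
  assumes "x \<in> carrier_vec m" "y \<in> carrier_vec n"
  shows "(k \<cdot>\<^sub>v x) \<otimes>\<^sub>v (l \<cdot>\<^sub>v y) = (k * l) \<cdot>\<^sub>v (x \<otimes>\<^sub>v y)"
  using assms by (intro eq_vecI) (auto simp: tensor_vec_def div_mod_less)

lemma tensor_one_mat: "1\<^sub>m m \<otimes>\<^sub>m 1\<^sub>m n = 1\<^sub>m (m * n)"
proof (rule eq_matI)
  fix i j
  assume "i < dim_row (1\<^sub>m (m * n) :: complex mat)" "j < dim_col (1\<^sub>m (m * n) :: complex mat)"
  then have ij: "i < m * n" "j < m * n" by auto
  have "i = j \<longleftrightarrow> i div n = j div n \<and> i mod n = j mod n"
    by (metis div_mult_mod_eq)
  then show "(1\<^sub>m m \<otimes>\<^sub>m 1\<^sub>m n) $$ (i, j) = (1\<^sub>m (m * n) :: complex mat) $$ (i, j)"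
    using ij div_mod_less[OF ij(1)] div_mod_less[OF ij(2)] by (auto simp: tensor_mat_def)
qed (auto simp: tensor_mat_def)

text \<open>Links the two bounds: for the two states of the game, this product vector, the direction
  of the separable witness, is the vector \<open>u - u'\<close> of the analysis of general
  measurements.\<close>

lemma tensor_minus_minus:
  assumes "a \<in> carrier_vec n" "b \<in> carrier_vec n"
  shows "(a - b) \<otimes>\<^sub>v (a - b) = (a \<otimes>\<^sub>v a + b \<otimes>\<^sub>v b) - (a \<otimes>\<^sub>v b + b \<otimes>\<^sub>v a)"
  using assms by (intro eq_vecI) (auto simp: tensor_vec_def div_mod_less algebra_simps)


section \<open>Rank-one operators\<close>

text \<open>The operator k |w><w| for \<open>w\<close> of any length; the weight \<open>k\<close>
  takes up the normalisation.\<close>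

definition rank_one :: "real \<Rightarrow> complex vec \<Rightarrow> complex mat" where
  "rank_one k w = mat (dim_vec w) (dim_vec w) (\<lambda>(i, j). complex_of_real k * (w $ i * cnj (w $ j)))"

lemma rank_one_carrier [simp]: "w \<in> carrier_vec d \<Longrightarrow> rank_one k w \<in> carrier_mat d d"
  by (auto simp: rank_one_def)

lemma rank_one_form:
  assumes "w \<in> carrier_vec d" "z \<in> carrier_vec d"
  shows "(rank_one k w *\<^sub>v z) \<bullet>c z = complex_of_real (k * (cmod (z \<bullet>c w))\<^sup>2)"
proof -
  have "rank_one k w *\<^sub>v z = (complex_of_real k * (z \<bullet>c w)) \<cdot>\<^sub>v w"
    using assms by (intro eq_vecI)
      (auto simp: rank_one_def scalar_prod_def sum_distrib_left sum_distrib_right mult_ac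
        intro!: sum.cong)
  then have "(rank_one k w *\<^sub>v z) \<bullet>c z = complex_of_real k * ((z \<bullet>c w) * cnj (z \<bullet>c w))"
    using assms by (simp add: cscalar_prod_smult_left[of _ d] cscalar_prod_cnj[of _ d])
  then show ?thesis by (simp only: complex_norm_square[symmetric] of_real_mult)
qed

lemma outcome_prob_rank_one:
  assumes "w \<in> carrier_vec d" "z \<in> carrier_vec d"
  shows "outcome_prob (rank_one k w) z = k * (cmod (z \<bullet>c w))\<^sup>2"
  unfolding outcome_prob_def rank_one_form[OF assms] by simp

lemma psd_rank_one: "w \<in> carrier_vec d \<Longrightarrow> 0 \<le> k \<Longrightarrow> psd d (rank_one k w)"
  by (auto simp: psd_def rank_one_form less_eq_complex_def)

lemma psd_add:
  assumes A: "psd d A" and B: "psd d B"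
  shows "psd d (A + B)"
proof -
  have c: "A \<in> carrier_mat d d" "B \<in> carrier_mat d d" using A B by (auto simp: psd_carrier)
  have "((A + B) *\<^sub>v z) \<bullet>c z = (A *\<^sub>v z) \<bullet>c z + (B *\<^sub>v z) \<bullet>c z" if "z \<in> carrier_vec d" for z
  proof -
    have "A *\<^sub>v z \<in> carrier_vec d" "B *\<^sub>v z \<in> carrier_vec d" using c that by auto
    then show ?thesis
      using c that by (simp add: add_mult_distrib_mat_vec[of _ d d] cscalar_prod_simps[where d = d])
  qed
  then show ?thesis using A B c by (simp add: psd_def)
qed

lemma psd_one_minus:
  assumes A: "psd d A"
    and le: "\<And>z. z \<in> carrier_vec d \<Longrightarrow> outcome_prob A z \<le> Re (z \<bullet>c z)"
  shows "psd d (1\<^sub>m d - A)"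
  unfolding psd_def
proof (intro conjI ballI)
  have c: "A \<in> carrier_mat d d" using A by (rule psd_carrier)
  then show "1\<^sub>m d - A \<in> carrier_mat d d" by auto
  fix z :: "complex vec"
  assume z: "z \<in> carrier_vec d"
  have "A *\<^sub>v z \<in> carrier_vec d" using c z by auto
  then have "((1\<^sub>m d - A) *\<^sub>v z) \<bullet>c z = z \<bullet>c z - complex_of_real (outcome_prob A z)"
    using c z psd_of_real[OF A z]
    by (simp add: minus_mult_distrib_mat_vec[of _ d d] cscalar_prod_simps[where d = d])
  then show "0 \<le> ((1\<^sub>m d - A) *\<^sub>v z) \<bullet>c z"
    using le[OF z] cscalar_prod_self_nonneg[of z] by (simp add: less_eq_complex_def)
qed

lemma povm_outcome_prob_sum:
  assumes "povm d E" "x \<in> carrier_vec d"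
  shows "outcome_prob (E Equal) x + outcome_prob (E Different) x + outcome_prob (E DontKnow) x
    = Re (x \<bullet>c x)"
proof -
  have c: "E b \<in> carrier_mat d d" for b using assms by (auto simp: povm_def psd_def)
  have "outcome_prob (E Equal) x + outcome_prob (E Different) x + outcome_prob (E DontKnow) x
    = outcome_prob (E Equal + E Different + E DontKnow) x"
    using c assms(2) by (simp add: outcome_prob_add_mat[of _ d])
  then show ?thesis using assms by (simp add: povm_def outcome_prob_def)
qed

section \<open>The comparison game\<close>

lemma expected_payoff_eq:
  "expected_payoff c \<psi> E =
    (outcome_prob (E Equal) (\<psi> X0 \<otimes>\<^sub>v \<psi> X0) + outcome_prob (E Equal) (\<psi> X1 \<otimes>\<^sub>v \<psi> X1)
      - c * (outcome_prob (E Equal) (\<psi> X0 \<otimes>\<^sub>v \<psi> X1) + outcome_prob (E Equal) (\<psi> X1 \<otimes>\<^sub>v \<psi> X0))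
    + (outcome_prob (E Different) (\<psi> X0 \<otimes>\<^sub>v \<psi> X1) + outcome_prob (E Different) (\<psi> X1 \<otimes>\<^sub>v \<psi> X0)
      - c * (outcome_prob (E Different) (\<psi> X0 \<otimes>\<^sub>v \<psi> X0)
        + outcome_prob (E Different) (\<psi> X1 \<otimes>\<^sub>v \<psi> X1)))) / 4"
  by (simp add: expected_payoff_def algebra_simps add_divide_distrib diff_divide_distrib)

text \<open>The phase is already fixed here, so the overlap is the positive real \<tau> itself;
  general states are brought to this form in the final theorem.\<close>

locale comparison_game =
  fixes n :: nat and \<psi> :: "label \<Rightarrow> complex vec" and \<tau> :: real
  assumes \<psi>_carrier [simp]: "\<psi> l \<in> carrier_vec n"
    and \<psi>_norm: "\<psi> l \<bullet>c \<psi> l = 1"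
    and overlap: "\<psi> X1 \<bullet>c \<psi> X0 = complex_of_real \<tau>"
    and \<tau>: "0 < \<tau>" "\<tau> < 1"
begin

definition "u = \<psi> X0 \<otimes>\<^sub>v \<psi> X0 + \<psi> X1 \<otimes>\<^sub>v \<psi> X1"
definition "w = \<psi> X0 \<otimes>\<^sub>v \<psi> X0 - \<psi> X1 \<otimes>\<^sub>v \<psi> X1"
definition "u' = \<psi> X0 \<otimes>\<^sub>v \<psi> X1 + \<psi> X1 \<otimes>\<^sub>v \<psi> X0"
definition "w' = \<psi> X0 \<otimes>\<^sub>v \<psi> X1 - \<psi> X1 \<otimes>\<^sub>v \<psi> X0"

lemma uw_carrier [simp]:
  "u \<in> carrier_vec (n * n)" "w \<in> carrier_vec (n * n)"
  "u' \<in> carrier_vec (n * n)" "w' \<in> carrier_vec (n * n)"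
  by (simp_all add: u_def w_def u'_def w'_def)

lemma overlap': "\<psi> X0 \<bullet>c \<psi> X1 = complex_of_real \<tau>"
  using cscalar_prod_cnj[of "\<psi> X1" n "\<psi> X0"] overlap by simp

lemma tensor_gram:
  "(\<psi> i \<otimes>\<^sub>v \<psi> j) \<bullet>c (\<psi> k \<otimes>\<^sub>v \<psi> l) = (\<psi> i \<bullet>c \<psi> k) * (\<psi> j \<bullet>c \<psi> l)"
  by (simp add: cscalar_prod_tensor[of _ n _ n])

text \<open>\<open>w\<close> and \<open>w'\<close> are orthogonal to each other and to
  \<open>u\<close>, \<open>u'\<close>, so along them the answer is known without error. The conflict
  lies in the plane of \<open>u\<close> and \<open>u'\<close>, where equal norms make
  \<open>u + u'\<close> and \<open>u - u'\<close> orthogonal.\<close>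

lemma gram:
  "u \<bullet>c u = complex_of_real (2 + 2 * \<tau>\<^sup>2)" "u' \<bullet>c u' = complex_of_real (2 + 2 * \<tau>\<^sup>2)"
  "u \<bullet>c u' = complex_of_real (4 * \<tau>)" "u' \<bullet>c u = complex_of_real (4 * \<tau>)"
  "w \<bullet>c w = complex_of_real (2 - 2 * \<tau>\<^sup>2)" "w' \<bullet>c w' = complex_of_real (2 - 2 * \<tau>\<^sup>2)"
  "w \<bullet>c w' = 0" "w' \<bullet>c w = 0" "w \<bullet>c u = 0" "w \<bullet>c u' = 0" "w' \<bullet>c u = 0" "w' \<bullet>c u' = 0"
  "u \<bullet>c w = 0" "u' \<bullet>c w = 0" "u \<bullet>c w' = 0" "u' \<bullet>c w' = 0"
  unfolding u_def w_def u'_def w'_def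
  by (simp_all add: cscalar_prod_simps[where d = "n * n"] tensor_gram \<psi>_norm overlap overlap'
      power2_eq_square)

section \<open>Upper bound on the payoff of all measurements\<close>

text \<open>The first summand is the contribution of \<open>w\<close> and \<open>w'\<close>, the
  second that of the plane of \<open>u\<close> and \<open>u'\<close>.\<close>

definition optimum :: "real \<Rightarrow> real" where
  "optimum c = ((1 - \<tau>\<^sup>2) + c / (c - 1) * (1 - \<tau>)\<^sup>2) / 2"

lemma expected_payoff_uw:
  assumes "strategy n E"
  shows "expected_payoff c \<psi> E =
    (outcome_prob (E Equal) u + outcome_prob (E Equal) w
      - c * (outcome_prob (E Equal) u' + outcome_prob (E Equal) w')
    + (outcome_prob (E Different) u' + outcome_prob (E Different) w'
      - c * (outcome_prob (E Different) u + outcome_prob (E Different) w))) / 8"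
proof -
  have c: "E b \<in> carrier_mat (n * n) (n * n)" for b
    using assms by (auto simp: strategy_def povm_def psd_def)
  have par: "outcome_prob (E b) (\<psi> i \<otimes>\<^sub>v \<psi> j) + outcome_prob (E b) (\<psi> k \<otimes>\<^sub>v \<psi> l)
    = (outcome_prob (E b) (\<psi> i \<otimes>\<^sub>v \<psi> j + \<psi> k \<otimes>\<^sub>v \<psi> l)
      + outcome_prob (E b) (\<psi> i \<otimes>\<^sub>v \<psi> j - \<psi> k \<otimes>\<^sub>v \<psi> l)) / 2" for b i j k l
    by (rule outcome_prob_parallelogram[OF c]) simp_all
  show ?thesis
    unfolding expected_payoff_eq par unfolding u_def w_def u'_def w'_def
    by (simp add: field_simps)
qed

lemma outcome_prob_minus_commute:
  assumes "A \<in> carrier_mat (n * n) (n * n)"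
  shows "outcome_prob A (u' - u) = outcome_prob A (u - u')"
proof -
  have "u' - u = (- 1) \<cdot>\<^sub>v (u - u')"
    by (intro eq_vecI) (auto simp: carrier_vecD[OF uw_carrier(1)] carrier_vecD[OF uw_carrier(3)])
  then show ?thesis using outcome_prob_smult[OF assms, of "u - u'" "- 1"] by simp
qed

lemma norm_u_minus_u': "(u - u') \<bullet>c (u - u') = complex_of_real (4 * (1 - \<tau>)\<^sup>2)"
  by (simp add: cscalar_prod_simps[where d = "n * n"] gram power2_eq_square algebra_simps)

text \<open>In the plane of \<open>u\<close> and \<open>u'\<close>,
  \<open>outcome_prob_diff_bound\<close> bounds each answer by the same multiple of its probability
  at \<open>u - u'\<close>, where the two answers together weigh at most the squared norm. For
  \<open>w\<close> and \<open>w'\<close> the penalties are dropped and the rewards bounded by the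
  squared norms.\<close>

lemma expected_payoff_le_optimum:
  assumes E: "strategy n E" and c: "c > 1"
  shows "expected_payoff c \<psi> E \<le> optimum c"
proof -
  have p: "psd (n * n) (E b)" for b using E by (auto simp: strategy_def povm_def)
  have nn: "0 \<le> outcome_prob (E b) x" if "x \<in> carrier_vec (n * n)" for b x
    using psd_outcome_prob_nonneg[OF p that] .
  have tot: "outcome_prob (E Equal) x + outcome_prob (E Different) x \<le> Re (x \<bullet>c x)"
    if "x \<in> carrier_vec (n * n)" for x
    using povm_outcome_prob_sum[of "n * n" E x] that E nn[OF that, of DontKnow]
    by (simp add: strategy_def)
  have "outcome_prob (E Equal) u - c * outcome_prob (E Equal) u'
      + (outcome_prob (E Different) u' - c * outcome_prob (E Different) u)
    \<le> c / (c - 1) * (outcome_prob (E Equal) (u - u') + outcome_prob (E Different) (u - u'))"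
    using outcome_prob_diff_bound[OF p uw_carrier(1,3) c, of Equal]
      outcome_prob_diff_bound[OF p uw_carrier(3,1) c, of Different]
      outcome_prob_minus_commute[OF psd_carrier[OF p]]
    by (simp add: distrib_left)
  also have "\<dots> \<le> c / (c - 1) * (4 * (1 - \<tau>)\<^sup>2)"
    using tot[of "u - u'"] c by (intro mult_left_mono) (auto simp: norm_u_minus_u')
  finally have 1: "outcome_prob (E Equal) u - c * outcome_prob (E Equal) u'
      + (outcome_prob (E Different) u' - c * outcome_prob (E Different) u)
    \<le> c / (c - 1) * (4 * (1 - \<tau>)\<^sup>2)" .
  have 2: "outcome_prob (E Equal) w \<le> 2 - 2 * \<tau>\<^sup>2" "outcome_prob (E Different) w' \<le> 2 - 2 * \<tau>\<^sup>2"
    using tot[of w] tot[of w'] nn[of w Different] nn[of w' Equal] by (simp_all add: gram)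
  define \<kappa> where "\<kappa> = c / (c - 1)"
  have 3: "0 \<le> c * outcome_prob (E Equal) w'" "0 \<le> c * outcome_prob (E Different) w"
    using nn c by simp_all
  show ?thesis
    unfolding expected_payoff_uw[OF E] optimum_def distrib_left \<kappa>_def[symmetric]
    using 1[folded \<kappa>_def, unfolded mult.left_commute[of \<kappa> 4]] 2 3 by argo
qed

section \<open>A measurement attaining the bound\<close>

text \<open>The amplitude makes \<open>opt_vec c 1\<close> orthogonal to \<open>u - c u'\<close> and \<open>opt_vec c (- 1)\<close> orthogonal to
  \<open>u' - c u\<close>, which is the equality case of the bound on the payoff.\<close>

definition opt_amp :: "real \<Rightarrow> real" where
  "opt_amp c = (c + 1) / (c - 1) * (1 - \<tau>) / (2 * (1 + \<tau>)\<^sup>2)"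

definition opt_vec :: "real \<Rightarrow> real \<Rightarrow> complex vec" where
  "opt_vec c \<sigma> = complex_of_real (opt_amp c) \<cdot>\<^sub>v (u + u')
    + complex_of_real (\<sigma> / (2 * (1 - \<tau>))) \<cdot>\<^sub>v (u - u')"

lemma opt_vec_carrier [simp]: "opt_vec c \<sigma> \<in> carrier_vec (n * n)"
  by (simp add: opt_vec_def)

text \<open>The first terms project onto \<open>w\<close> and \<open>w'\<close>. The second branch
  also covers \<open>DontKnow\<close>, a value that \<open>opt_strategy\<close> never reads.\<close>

definition opt_accept :: "real \<Rightarrow> answer \<Rightarrow> complex mat" where
  "opt_accept c b = (if b = Equal
    then rank_one (1 / (2 - 2 * \<tau>\<^sup>2)) w + rank_one (1 / 2) (opt_vec c 1)
    else rank_one (1 / (2 - 2 * \<tau>\<^sup>2)) w' + rank_one (1 / 2) (opt_vec c (- 1)))"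

definition opt_strategy :: "real \<Rightarrow> answer \<Rightarrow> complex mat" where
  "opt_strategy c b = (case b of
      DontKnow \<Rightarrow> 1\<^sub>m (n * n) - (opt_accept c Equal + opt_accept c Different)
    | _ \<Rightarrow> opt_accept c b)"

lemma norm_w_pos: "2 - 2 * \<tau>\<^sup>2 > 0"
  using \<tau> by (simp add: abs_square_less_1)

lemma opt_accept_psd: "psd (n * n) (opt_accept c b)"
  using norm_w_pos unfolding opt_accept_def by (auto intro!: psd_add psd_rank_one)

lemma outcome_prob_opt_accept:
  assumes "z \<in> carrier_vec (n * n)"
  shows "outcome_prob (opt_accept c Equal) z =
      (cmod (z \<bullet>c w))\<^sup>2 / (2 - 2 * \<tau>\<^sup>2) + (cmod (z \<bullet>c opt_vec c 1))\<^sup>2 / 2"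
    and "outcome_prob (opt_accept c Different) z =
      (cmod (z \<bullet>c w'))\<^sup>2 / (2 - 2 * \<tau>\<^sup>2) + (cmod (z \<bullet>c opt_vec c (- 1)))\<^sup>2 / 2"
  using assms unfolding opt_accept_def
  by (simp_all add: outcome_prob_add_mat[of _ "n * n"] outcome_prob_rank_one[of _ "n * n"])

lemma cscalar_prod_opt_vec:
  assumes "z \<in> carrier_vec (n * n)"
  shows "z \<bullet>c opt_vec c \<sigma> = complex_of_real (opt_amp c) * (z \<bullet>c (u + u'))
    + complex_of_real (\<sigma> / (2 * (1 - \<tau>))) * (z \<bullet>c (u - u'))"
proof -
  have "u + u' \<in> carrier_vec (n * n)" "u - u' \<in> carrier_vec (n * n)" by simp_all
  then show ?thesis
    unfolding opt_vec_def using assms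
    by (simp only: cscalar_prod_add_right[where d = "n * n"] smult_carrier_vec
        cscalar_prod_smult_right[where d = "n * n"] complex_cnj_complex_of_real)
qed

text \<open>Bessel's inequality for \<open>w\<close>, \<open>w'\<close>, \<open>u - u'\<close>,
  \<open>u + u'\<close>. The accepted weight already exhausts the first three directions; the bound
  on \<open>opt_amp\<close> says that the direction \<open>u + u'\<close> is not exceeded.\<close>

lemma opt_accept_le:
  assumes z: "z \<in> carrier_vec (n * n)"
    and amp: "0 \<le> opt_amp c" "opt_amp c \<le> 1 / (2 * (1 + \<tau>))"
  shows "outcome_prob (opt_accept c Equal + opt_accept c Different) z \<le> Re (z \<bullet>c z)"
proof -
  define x where "x i = [w, w', u - u', u + u'] ! i" for i
  define g where "g i = [2 - 2 * \<tau>\<^sup>2, 2 - 2 * \<tau>\<^sup>2, 4 * (1 - \<tau>)\<^sup>2, 4 * (1 + \<tau>)\<^sup>2] ! i" for i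
  have I: "{..<4::nat} = {0, 1, 2, 3}" by auto
  have "(\<Sum>i<4. (cmod (z \<bullet>c x i))\<^sup>2 / g i) \<le> Re (z \<bullet>c z)"
  proof (rule bessel_inequality[OF _ z])
    fix i :: nat
    assume i: "i \<in> {..<4}"
    show "x i \<in> carrier_vec (n * n)"
      using i unfolding I by (auto simp: x_def)
    show "x i \<bullet>c x i = complex_of_real (g i)"
      using i unfolding I by (auto simp: x_def g_def cscalar_prod_simps[where d = "n * n"] gram
          power2_eq_square algebra_simps)
    show "0 < g i"
      using i norm_w_pos \<tau> unfolding I by (auto simp: g_def)
    fix j :: nat
    assume "j \<in> {..<4}" "i \<noteq> j"
    then show "x i \<bullet>c x j = 0"
      using i unfolding I by (auto simp: x_def cscalar_prod_simps[where d = "n * n"] gram)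
  qed simp
  then have bes: "(cmod (z \<bullet>c w))\<^sup>2 / (2 - 2 * \<tau>\<^sup>2) + (cmod (z \<bullet>c w'))\<^sup>2 / (2 - 2 * \<tau>\<^sup>2)
    + (cmod (z \<bullet>c (u - u')))\<^sup>2 / (4 * (1 - \<tau>)\<^sup>2) + (cmod (z \<bullet>c (u + u')))\<^sup>2 / (4 * (1 + \<tau>)\<^sup>2)
    \<le> Re (z \<bullet>c z)"
    unfolding I by (simp add: x_def g_def numeral_2_eq_2 numeral_3_eq_3)
  \<comment> \<open>The two optimal vectors differ in the sign of their \<open>u - u'\<close> part,
    so by this identity the cross terms cancel in the sum of the two answers.\<close>
  have par: "(cmod (p + q))\<^sup>2 + (cmod (p - q))\<^sup>2 = 2 * (cmod p)\<^sup>2 + 2 * (cmod q)\<^sup>2" for p q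
    unfolding cmod_power2 by (simp add: power2_eq_square algebra_simps)
  define p where "p = complex_of_real (opt_amp c) * (z \<bullet>c (u + u'))"
  define q where "q = complex_of_real (1 / (2 * (1 - \<tau>))) * (z \<bullet>c (u - u'))"
  have "z \<bullet>c opt_vec c 1 = p + q" "z \<bullet>c opt_vec c (- 1) = p - q"
    unfolding cscalar_prod_opt_vec[OF z] p_def q_def by simp_all
  then have "(cmod (z \<bullet>c opt_vec c 1))\<^sup>2 / 2 + (cmod (z \<bullet>c opt_vec c (- 1)))\<^sup>2 / 2
    = (cmod p)\<^sup>2 + (cmod q)\<^sup>2"
    using par[of p q] by simp
  moreover have "(cmod q)\<^sup>2 = (cmod (z \<bullet>c (u - u')))\<^sup>2 / (4 * (1 - \<tau>)\<^sup>2)"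
    unfolding q_def norm_mult power_mult_distrib norm_of_real power2_abs power_divide by simp
  moreover have "(cmod p)\<^sup>2 \<le> (cmod (z \<bullet>c (u + u')))\<^sup>2 / (4 * (1 + \<tau>)\<^sup>2)"
  proof -
    have "(opt_amp c)\<^sup>2 \<le> (1 / (2 * (1 + \<tau>)))\<^sup>2" using amp by (intro power_mono)
    also have "\<dots> = 1 / (4 * (1 + \<tau>)\<^sup>2)"
      unfolding power_divide power_mult_distrib by simp
    finally have "(opt_amp c)\<^sup>2 * (cmod (z \<bullet>c (u + u')))\<^sup>2
      \<le> 1 / (4 * (1 + \<tau>)\<^sup>2) * (cmod (z \<bullet>c (u + u')))\<^sup>2"
      by (rule mult_right_mono) simp
    then show ?thesis
      unfolding p_def norm_mult power_mult_distrib norm_of_real by simp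
  qed
  moreover have "outcome_prob (opt_accept c Equal + opt_accept c Different) z
    = outcome_prob (opt_accept c Equal) z + outcome_prob (opt_accept c Different) z"
    using opt_accept_psd z by (intro outcome_prob_add_mat[of _ "n * n"]) (auto simp: psd_carrier)
  ultimately show ?thesis
    using bes unfolding outcome_prob_opt_accept[OF z] by linarith
qed

lemma opt_strategy:
  assumes "0 \<le> opt_amp c" "opt_amp c \<le> 1 / (2 * (1 + \<tau>))"
  shows "strategy n (opt_strategy c)"
proof -
  define S where "S = opt_accept c Equal + opt_accept c Different"
  have S: "psd (n * n) S" unfolding S_def by (intro psd_add opt_accept_psd)
  have R: "psd (n * n) (1\<^sub>m (n * n) - S)"
    using opt_accept_le assms S unfolding S_def by (intro psd_one_minus)
  have "psd (n * n) (opt_strategy c b)" for b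
    using opt_accept_psd R by (cases b) (simp_all add: opt_strategy_def S_def)
  moreover have "S + (1\<^sub>m (n * n) - S) = 1\<^sub>m (n * n)"
    using psd_carrier[OF S] by (intro eq_matI) auto
  then have "opt_strategy c Equal + opt_strategy c Different + opt_strategy c DontKnow
    = 1\<^sub>m (n * n)"
    by (simp add: opt_strategy_def S_def)
  ultimately show ?thesis by (simp add: strategy_def povm_def)
qed

lemma opt_strategy_payoff:
  assumes c: "c > 1" and S: "strategy n (opt_strategy c)"
  shows "expected_payoff c \<psi> (opt_strategy c) = optimum c"
proof -
  \<comment> \<open>The inner products of \<open>opt_vec c \<sigma>\<close> with \<open>u\<close>
    and \<open>u'\<close> become \<open>k + \<sigma>\<close> and \<open>k - \<sigma>\<close> times
    \<open>1 - \<tau>\<close>.\<close>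
  define k where "k = (c + 1) / (c - 1)"
  have amp: "opt_amp c * (2 * (1 + \<tau>)\<^sup>2) = k * (1 - \<tau>)"
    using \<tau> by (simp add: opt_amp_def k_def)
  have half: "\<sigma> / (2 * (1 - \<tau>)) * (2 * (1 - \<tau>)\<^sup>2) = \<sigma> * (1 - \<tau>)" for \<sigma>
  proof -
    have "\<sigma> / (2 * e) * (2 * e\<^sup>2) = \<sigma> * e" if "e \<noteq> 0" for e :: real
      using that by (simp add: power2_eq_square)
    then show ?thesis by this (use \<tau> in simp)
  qed
  have g: "u \<bullet>c (u + u') = complex_of_real (2 * (1 + \<tau>)\<^sup>2)"
    "u' \<bullet>c (u + u') = complex_of_real (2 * (1 + \<tau>)\<^sup>2)"
    "u \<bullet>c (u - u') = complex_of_real (2 * (1 - \<tau>)\<^sup>2)"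
    "u' \<bullet>c (u - u') = complex_of_real (- (2 * (1 - \<tau>)\<^sup>2))"
    "w \<bullet>c (u + u') = 0" "w' \<bullet>c (u + u') = 0" "w \<bullet>c (u - u') = 0" "w' \<bullet>c (u - u') = 0"
    by (simp_all add: cscalar_prod_simps[where d = "n * n"] gram power2_eq_square algebra_simps)
  have uo: "u \<bullet>c opt_vec c \<sigma> = complex_of_real ((k + \<sigma>) * (1 - \<tau>))" for \<sigma>
  proof -
    have "u \<bullet>c opt_vec c \<sigma> = complex_of_real (opt_amp c * (2 * (1 + \<tau>)\<^sup>2)
      + \<sigma> / (2 * (1 - \<tau>)) * (2 * (1 - \<tau>)\<^sup>2))"
      unfolding cscalar_prod_opt_vec[OF uw_carrier(1)] g by (simp only: of_real_mult of_real_add)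
    then show ?thesis unfolding amp half by (simp add: distrib_right)
  qed
  have u'o: "u' \<bullet>c opt_vec c \<sigma> = complex_of_real ((k - \<sigma>) * (1 - \<tau>))" for \<sigma>
  proof -
    have "u' \<bullet>c opt_vec c \<sigma> = complex_of_real (opt_amp c * (2 * (1 + \<tau>)\<^sup>2)
      - \<sigma> / (2 * (1 - \<tau>)) * (2 * (1 - \<tau>)\<^sup>2))"
      unfolding cscalar_prod_opt_vec[OF uw_carrier(3)] g
      by (simp only: of_real_mult of_real_diff of_real_minus mult_minus_right) simp
    then show ?thesis unfolding amp half by (simp add: left_diff_distrib)
  qed
  have wo: "w \<bullet>c opt_vec c \<sigma> = 0" "w' \<bullet>c opt_vec c \<sigma> = 0" for \<sigma>
    by (simp_all add: cscalar_prod_opt_vec g)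
  have sq: "(cmod (complex_of_real x))\<^sup>2 = x\<^sup>2" for x by simp
  \<comment> \<open>Valid at 0 as well, since division by zero yields 0.\<close>
  have nw: "x\<^sup>2 / x = x" for x :: real by (simp add: power2_eq_square)
  have "k + 1 = 2 * c / (c - 1)" "k - 1 = 2 / (c - 1)"
    using c by (simp_all add: k_def field_simps)
  then have "(k + 1)\<^sup>2 - c * (k - 1)\<^sup>2 = (4 * c * (c - 1)) / (c - 1)\<^sup>2"
    by (simp add: power_divide diff_divide_distrib[symmetric] power2_eq_square algebra_simps)
  also have "\<dots> = 4 * c / (c - 1)" using c by (simp add: power2_eq_square)
  finally have kk: "(k + 1)\<^sup>2 - c * (k - 1)\<^sup>2 = 4 * (c / (c - 1))" by simp
  have "expected_payoff c \<psi> (opt_strategy c)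
    = (((k + 1)\<^sup>2 - c * (k - 1)\<^sup>2) * (1 - \<tau>)\<^sup>2 + 2 * (2 - 2 * \<tau>\<^sup>2)) / 8"
    unfolding expected_payoff_uw[OF S]
    by (simp only: opt_strategy_def answer.case outcome_prob_opt_accept uw_carrier
        uo u'o wo gram sq nw power_mult_distrib)
      (simp add: algebra_simps)
  also have "\<dots> = optimum c" unfolding kk optimum_def by argo
  finally show ?thesis .
qed

text \<open>The second hypothesis amounts to \<open>c * \<tau> \<ge> 1\<close> and is what keeps
  \<open>opt_amp c\<close> small enough for a valid measurement. \<open>GREATEST\<close> requires an
  attained value, hence the explicit strategy next to the upper bound.\<close>

lemma p_max_eq_optimum:
  assumes c: "c > 1" and cl: "(c + 1) * (1 - \<tau>) \<le> (c - 1) * (1 + \<tau>)"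
  shows "p_max n c \<psi> = optimum c"
proof -
  have "0 \<le> opt_amp c" using c \<tau> by (simp add: opt_amp_def)
  moreover have "opt_amp c \<le> 1 / (2 * (1 + \<tau>))"
  proof -
    have "(c + 1) / (c - 1) * (1 - \<tau>) \<le> 1 + \<tau>" using c cl by (simp add: field_simps)
    then have "opt_amp c \<le> (1 + \<tau>) / (2 * (1 + \<tau>)\<^sup>2)"
      unfolding opt_amp_def using \<tau> by (intro divide_right_mono) auto
    then show ?thesis using \<tau> by (simp add: power2_eq_square)
  qed
  ultimately have S: "strategy n (opt_strategy c)" by (rule opt_strategy)
  show ?thesis
    unfolding p_max_def
  proof (rule Greatest_equality)
    show "optimum c \<in> expected_payoff c \<psi> ` {E. strategy n E}"
      using opt_strategy_payoff[OF c S] S by (auto intro!: image_eqI[of _ _ "opt_strategy c"])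
  qed (use expected_payoff_le_optimum[OF _ c] in auto)
qed

end

section \<open>Bound for separable measurements\<close>

text \<open>Block positivity of the separable witness. With \<open>x = p p' + q q'\<close> and
  \<open>y = p q' + q p'\<close> one has \<open>x\<^sup>2 \<le> (1 + \<delta>) (x - y)\<^sup>2 + (1 + 1 / \<delta>) y\<^sup>2\<close>.\<close>

lemma product_witness:
  fixes p q p' q' \<delta> c :: real
  assumes nn: "0 \<le> p" "0 \<le> q" "0 \<le> p'" "0 \<le> q'" and \<delta>: "\<delta> > 0" and c: "c \<ge> 2 * (1 + 1 / \<delta>)"
  shows "p\<^sup>2 * p'\<^sup>2 + q\<^sup>2 * q'\<^sup>2 - c * (p\<^sup>2 * q'\<^sup>2 + q\<^sup>2 * p'\<^sup>2)
    \<le> (1 + \<delta>) * ((p - q)\<^sup>2 * (p' - q')\<^sup>2)"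
proof -
  define x y where "x = p * p' + q * q'" and "y = p * q' + q * p'"
  \<comment> \<open>This quotient is the exact slack of the inequality between \<open>x\<close> and
    \<open>y\<close>.\<close>
  have "0 \<le> (\<delta> * x - (1 + \<delta>) * y)\<^sup>2 / \<delta>" using \<delta> by simp
  also have "\<dots> = (1 + \<delta>) * (x - y)\<^sup>2 - x\<^sup>2 + (1 + 1 / \<delta>) * y\<^sup>2"
    using \<delta> by (simp add: field_simps power2_eq_square)
  finally have 1: "x\<^sup>2 - (1 + 1 / \<delta>) * y\<^sup>2 \<le> (1 + \<delta>) * (x - y)\<^sup>2" by simp
  have "x - y = (p - q) * (p' - q')" by (simp add: x_def y_def algebra_simps)
  then have 2: "(x - y)\<^sup>2 = (p - q)\<^sup>2 * (p' - q')\<^sup>2" by (simp add: power_mult_distrib)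
  have "0 \<le> 2 * (p * p') * (q * q')" using nn by simp
  then have 3: "p\<^sup>2 * p'\<^sup>2 + q\<^sup>2 * q'\<^sup>2 \<le> x\<^sup>2"
    by (simp add: x_def power2_eq_square algebra_simps)
  \<comment> \<open>Passing from \<open>y\<^sup>2\<close> to the sum of the two squares costs the
    factor 2 in the condition on \<open>c\<close>.\<close>
  have "0 \<le> (p * q' - q * p')\<^sup>2" by simp
  then have "y\<^sup>2 \<le> 2 * (p\<^sup>2 * q'\<^sup>2 + q\<^sup>2 * p'\<^sup>2)"
    by (simp add: y_def power2_eq_square algebra_simps)
  then have "(1 + 1 / \<delta>) * y\<^sup>2 \<le> (1 + 1 / \<delta>) * (2 * (p\<^sup>2 * q'\<^sup>2 + q\<^sup>2 * p'\<^sup>2))"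
    using \<delta> by (intro mult_left_mono) auto
  also have "\<dots> = 2 * (1 + 1 / \<delta>) * (p\<^sup>2 * q'\<^sup>2 + q\<^sup>2 * p'\<^sup>2)"
    by (simp add: algebra_simps)
  also have "\<dots> \<le> c * (p\<^sup>2 * q'\<^sup>2 + q\<^sup>2 * p'\<^sup>2)"
    using c by (intro mult_right_mono) auto
  finally show ?thesis using 1 3 unfolding 2 by linarith
qed

text \<open>On product operators the square roots of the outcome probabilities are seminorms of the two
  factors, so the reverse triangle inequality reduces the claim to four real numbers.\<close>

lemma product_op_witness:
  assumes F: "psd n F" and G: "psd n G"
    and a: "a \<in> carrier_vec n" and b: "b \<in> carrier_vec n" and a': "a' \<in> carrier_vec n"
    and b': "b' \<in> carrier_vec n"
    and \<delta>: "\<delta> > 0" and c: "c \<ge> 2 * (1 + 1 / \<delta>)"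
  shows "outcome_prob (F \<otimes>\<^sub>m G) (a \<otimes>\<^sub>v a') + outcome_prob (F \<otimes>\<^sub>m G) (b \<otimes>\<^sub>v b')
      - c * (outcome_prob (F \<otimes>\<^sub>m G) (a \<otimes>\<^sub>v b') + outcome_prob (F \<otimes>\<^sub>m G) (b \<otimes>\<^sub>v a'))
    \<le> (1 + \<delta>) * outcome_prob (F \<otimes>\<^sub>m G) ((a - b) \<otimes>\<^sub>v (a' - b'))"
proof -
  have ab: "a - b \<in> carrier_vec n" "a' - b' \<in> carrier_vec n" using a b a' b' by auto
  note nF = psd_outcome_prob_nonneg[OF F] and nG = psd_outcome_prob_nonneg[OF G]
  note t = outcome_prob_tensor[OF F G]
  define p q p' q' where "p = sqrt (outcome_prob F a)" and "q = sqrt (outcome_prob F b)"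
    and "p' = sqrt (outcome_prob G a')" and "q' = sqrt (outcome_prob G b')"
  have sq: "outcome_prob F a = p\<^sup>2" "outcome_prob F b = q\<^sup>2"
    "outcome_prob G a' = p'\<^sup>2" "outcome_prob G b' = q'\<^sup>2"
    "0 \<le> p" "0 \<le> q" "0 \<le> p'" "0 \<le> q'"
    using nF nG a b a' b' by (simp_all add: p_def q_def p'_def q'_def)
  have "(p - q)\<^sup>2 * (p' - q')\<^sup>2 \<le> outcome_prob F (a - b) * outcome_prob G (a' - b')"
    using outcome_prob_minus_ge[OF F a b] outcome_prob_minus_ge[OF G a' b'] nF[OF ab(1)]
    unfolding p_def q_def p'_def q'_def by (intro mult_mono) auto
  then have "(1 + \<delta>) * ((p - q)\<^sup>2 * (p' - q')\<^sup>2)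
    \<le> (1 + \<delta>) * (outcome_prob F (a - b) * outcome_prob G (a' - b'))"
    using \<delta> by (intro mult_left_mono) auto
  then show ?thesis
    using product_witness[OF sq(5-8) \<delta> c]
    unfolding t[OF a a'] t[OF b b'] t[OF a b'] t[OF b a'] t[OF ab] sq by linarith
qed

text \<open>Both sides are additive in the operator, so the bound passes from products to finite
  sums. The dimension is carried through the induction because additivity needs it.\<close>

lemma separable_op_witness:
  assumes A: "separable_op n A"
    and a: "a \<in> carrier_vec n" and b: "b \<in> carrier_vec n" and a': "a' \<in> carrier_vec n"
    and b': "b' \<in> carrier_vec n"
    and \<delta>: "\<delta> > 0" and c: "c \<ge> 2 * (1 + 1 / \<delta>)"
  shows "outcome_prob A (a \<otimes>\<^sub>v a') + outcome_prob A (b \<otimes>\<^sub>v b')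
      - c * (outcome_prob A (a \<otimes>\<^sub>v b') + outcome_prob A (b \<otimes>\<^sub>v a'))
    \<le> (1 + \<delta>) * outcome_prob A ((a - b) \<otimes>\<^sub>v (a' - b'))"
    (is "?lhs A \<le> ?rhs A")
proof -
  obtain Fs where Fs: "\<forall>(F0, F1) \<in> set Fs. psd n F0 \<and> psd n F1"
    and A: "A = foldr (\<lambda>(F0, F1) S. F0 \<otimes>\<^sub>m F1 + S) Fs (0\<^sub>m (n * n) (n * n))"
    using A by (auto simp: separable_op_def)
  have "A \<in> carrier_mat (n * n) (n * n) \<and> ?lhs A \<le> ?rhs A"
    unfolding A using Fs
  proof (induction Fs)
    case Nil
    have "outcome_prob (0\<^sub>m (n * n) (n * n)) (x \<otimes>\<^sub>v y) = 0"
      if "x \<in> carrier_vec n" "y \<in> carrier_vec n" for x y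
      using that by (intro outcome_prob_zero) simp
    then show ?case using a b a' b' by simp
  next
    case (Cons FG Fs)
    obtain F G where FG: "FG = (F, G)" by force
    define S where "S = foldr (\<lambda>(F0, F1) S. F0 \<otimes>\<^sub>m F1 + S) Fs (0\<^sub>m (n * n) (n * n))"
    have P: "psd n F" "psd n G" using Cons.prems FG by auto
    have S: "S \<in> carrier_mat (n * n) (n * n)" "?lhs S \<le> ?rhs S"
      using Cons unfolding S_def by auto
    have T: "F \<otimes>\<^sub>m G \<in> carrier_mat (n * n) (n * n)" using P by (simp add: psd_carrier)
    have "outcome_prob (F \<otimes>\<^sub>m G + S) (x \<otimes>\<^sub>v y)
      = outcome_prob (F \<otimes>\<^sub>m G) (x \<otimes>\<^sub>v y) + outcome_prob S (x \<otimes>\<^sub>v y)"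
      if "x \<in> carrier_vec n" "y \<in> carrier_vec n" for x y
      using T S that by (intro outcome_prob_add_mat) auto
    then have "?lhs (F \<otimes>\<^sub>m G + S) = ?lhs (F \<otimes>\<^sub>m G) + ?lhs S"
      "?rhs (F \<otimes>\<^sub>m G + S) = ?rhs (F \<otimes>\<^sub>m G) + ?rhs S"
      using a b a' b' by (simp_all add: algebra_simps)
    then have "?lhs (F \<otimes>\<^sub>m G + S) \<le> ?rhs (F \<otimes>\<^sub>m G + S)"
      using product_op_witness[OF P a b a' b' \<delta> c] S by linarith
    then show ?case using T S by (simp add: FG S_def)
  qed
  then show ?thesis ..
qed

text \<open>Always answering "don't know" works, its identity being a product of identities.
  Nonemptiness is needed to bound the supremum.\<close>

lemma separable_strategy_exists: "\<exists>E. separable_strategy n E"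
proof -
  define E :: "answer \<Rightarrow> complex mat" where "E b = (case b of DontKnow \<Rightarrow> 1\<^sub>m (n * n) | _ \<Rightarrow> 0\<^sub>m (n * n) (n * n))" for b
  have "psd (n * n) (E b)" for b
    by (cases b) (simp_all add: E_def psd_zero psd_one)
  moreover have "separable_op n (0\<^sub>m (n * n) (n * n))"
    unfolding separable_op_def by (intro exI[of _ "[]"]) simp
  moreover have "separable_op n (1\<^sub>m (n * n))"
    unfolding separable_op_def
    by (intro exI[of _ "[(1\<^sub>m n, 1\<^sub>m n)]"]) (simp add: psd_one tensor_one_mat)
  ultimately have "separable_strategy n E"
    unfolding separable_strategy_def strategy_def povm_def
    by (auto simp: E_def split: answer.split)
  then show ?thesis by blast
qed

context comparison_game
begin

text \<open>Both answers are dominated by the same positive form at the product vector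
  \<open>d\<close>, whose squared norm is \<open>4 * (1 - \<tau>)\<^sup>2\<close>; the 4 cancels
  against the prior probability.\<close>

lemma separable_payoff_le:
  assumes E: "separable_strategy n E" and \<delta>: "\<delta> > 0" and c: "c \<ge> 2 * (1 + 1 / \<delta>)"
  shows "expected_payoff c \<psi> E \<le> (1 + \<delta>) * (1 - \<tau>)\<^sup>2"
proof -
  define d where "d = (\<psi> X0 - \<psi> X1) \<otimes>\<^sub>v (\<psi> X0 - \<psi> X1)"
  have d: "d = u - u'" unfolding d_def u_def u'_def by (rule tensor_minus_minus[where n = n]) simp_all
  have dc: "d \<in> carrier_vec (n * n)" unfolding d by simp
  have pv: "povm (n * n) E" using E by (simp add: separable_strategy_def strategy_def)
  have s: "separable_op n (E b)" for b using E by (simp add: separable_strategy_def)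
  note wit = separable_op_witness[OF s \<psi>_carrier \<psi>_carrier \<psi>_carrier \<psi>_carrier \<delta> c]
  \<comment> \<open>For \<open>Different\<close> the states of the second factor trade places, which
    only changes the sign of \<open>d\<close>.\<close>
  have swap: "(\<psi> X0 - \<psi> X1) \<otimes>\<^sub>v (\<psi> X1 - \<psi> X0) = (- 1) \<cdot>\<^sub>v d"
  proof -
    have "\<psi> X1 - \<psi> X0 = (- 1) \<cdot>\<^sub>v (\<psi> X0 - \<psi> X1)"
      by (intro eq_vecI) (auto simp: carrier_vecD[OF \<psi>_carrier])
    then show ?thesis
      unfolding d_def
      using tensor_vec_smult[of "\<psi> X0 - \<psi> X1" n "\<psi> X0 - \<psi> X1" n 1 "- 1"] by simp
  qed
  have carr: "E Different \<in> carrier_mat (n * n) (n * n)"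
    using pv by (simp add: povm_def psd_carrier)
  have 0: "outcome_prob (E Equal) (\<psi> X0 \<otimes>\<^sub>v \<psi> X0) + outcome_prob (E Equal) (\<psi> X1 \<otimes>\<^sub>v \<psi> X1)
      - c * (outcome_prob (E Equal) (\<psi> X0 \<otimes>\<^sub>v \<psi> X1) + outcome_prob (E Equal) (\<psi> X1 \<otimes>\<^sub>v \<psi> X0))
    \<le> (1 + \<delta>) * outcome_prob (E Equal) d"
    using wit[of Equal X0 X0 X1 X1] unfolding d_def by simp
  have 1: "outcome_prob (E Different) (\<psi> X0 \<otimes>\<^sub>v \<psi> X1) + outcome_prob (E Different) (\<psi> X1 \<otimes>\<^sub>v \<psi> X0)
      - c * (outcome_prob (E Different) (\<psi> X0 \<otimes>\<^sub>v \<psi> X0) + outcome_prob (E Different) (\<psi> X1 \<otimes>\<^sub>v \<psi> X1))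
    \<le> (1 + \<delta>) * outcome_prob (E Different) d"
    using wit[of Different X0 X1 X1 X0] outcome_prob_smult[OF carr dc, of "- 1"]
    unfolding swap by simp
  have "outcome_prob (E Equal) d + outcome_prob (E Different) d \<le> 4 * (1 - \<tau>)\<^sup>2"
    using povm_outcome_prob_sum[OF pv dc] psd_outcome_prob_nonneg[of "n * n" "E DontKnow" d] pv dc
      norm_u_minus_u'
    by (simp add: d povm_def)
  then have "(1 + \<delta>) * (outcome_prob (E Equal) d + outcome_prob (E Different) d)
    \<le> (1 + \<delta>) * (4 * (1 - \<tau>)\<^sup>2)"
    using \<delta> by (intro mult_left_mono) auto
  then show ?thesis
    unfolding expected_payoff_eq using 0 1 by (simp add: distrib_left)
qed

text \<open>This \<open>c\<close> is the least one that the separable bound allows for \<delta> =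
  \<tau>, and it also satisfies the condition under which the optimum is attained.\<close>

lemma p_sep_gap:
  assumes c: "c = 2 * (1 + 1 / \<tau>)"
  shows "p_sep n c \<psi> \<le> p_max n c \<psi> - \<tau>\<^sup>2 * (1 - \<tau>)"
proof -
  have c1: "c > 1" using c \<tau> by (simp add: add_pos_pos)
  have "p_sep n c \<psi> \<le> (1 + \<tau>) * (1 - \<tau>)\<^sup>2"
    unfolding p_sep_def
    using separable_strategy_exists[of n] separable_payoff_le[OF _ \<tau>(1)] c
    by (intro cSup_least) auto
  moreover have "p_max n c \<psi> = optimum c"
  proof (rule p_max_eq_optimum[OF c1])
    have "1 \<le> c * \<tau>" using \<tau> by (simp add: c distrib_right)
    then show "(c + 1) * (1 - \<tau>) \<le> (c - 1) * (1 + \<tau>)" by (simp add: algebra_simps)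
  qed
  \<comment> \<open>Replacing \<open>c / (c - 1)\<close> by 1 turns \<open>optimum c\<close> into
    exactly \<open>1 - \<tau>\<close>.\<close>
  moreover have "1 - \<tau> \<le> optimum c"
  proof -
    have "1 * (1 - \<tau>)\<^sup>2 \<le> c / (c - 1) * (1 - \<tau>)\<^sup>2"
      using c1 by (intro mult_right_mono) (auto simp: field_simps)
    then show ?thesis by (simp add: optimum_def power2_eq_square algebra_simps)
  qed
  moreover have "(1 + \<tau>) * (1 - \<tau>)\<^sup>2 = (1 - \<tau>) - \<tau>\<^sup>2 * (1 - \<tau>)"
    by (simp add: power2_eq_square algebra_simps)
  ultimately show ?thesis by linarith
qed

end

section \<open>Removing the phase of the overlap\<close>

text \<open>Each product state only acquires a factor of modulus 1, to which quadratic forms are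
  blind.\<close>

lemma expected_payoff_phase:
  assumes E: "strategy n E" and \<psi>: "\<And>l. \<psi> l \<in> carrier_vec n" and \<phi>: "\<And>l. cmod (\<phi> l) = 1"
  shows "expected_payoff c (\<lambda>l. \<phi> l \<cdot>\<^sub>v \<psi> l) E = expected_payoff c \<psi> E"
proof -
  have "E b \<in> carrier_mat (n * n) (n * n)" for b
    using E by (auto simp: strategy_def povm_def psd_def)
  then have "outcome_prob (E b) ((\<phi> i \<cdot>\<^sub>v \<psi> i) \<otimes>\<^sub>v (\<phi> j \<cdot>\<^sub>v \<psi> j))
    = outcome_prob (E b) (\<psi> i \<otimes>\<^sub>v \<psi> j)" for b i j
    using \<psi> \<phi> by (simp add: tensor_vec_smult[of _ n _ n] outcome_prob_smult[of _ "n * n"] norm_mult)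
  then show ?thesis unfolding expected_payoff_eq by simp
qed

theorem theorem7p1:
  shows "\<exists>f :: real \<Rightarrow> real.
    (\<forall>\<tau>. 0 < \<tau> \<and> \<tau> < 1 \<longrightarrow> f \<tau> > 0) \<and>
    (\<forall>(\<tau>::real) (n::nat) (\<psi> :: label \<Rightarrow> complex vec).
       0 < \<tau> \<and> \<tau> < 1 \<and> pure_state n (\<psi> X0) \<and> pure_state n (\<psi> X1) \<and>
       cmod (\<psi> X1 \<bullet>c \<psi> X0) = \<tau> \<longrightarrow>
       (\<exists>c>0. p_sep n c \<psi> \<le> p_max n c \<psi> - f \<tau>))"
proof (intro exI[of _ "\<lambda>\<tau>. \<tau>\<^sup>2 * (1 - \<tau>)"] conjI allI impI)
  fix \<tau> :: real
  assume "0 < \<tau> \<and> \<tau> < 1"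
  then show "0 < \<tau>\<^sup>2 * (1 - \<tau>)" by simp
next
  fix \<tau> :: real and n :: nat and \<psi> :: "label \<Rightarrow> complex vec"
  assume asm: "0 < \<tau> \<and> \<tau> < 1 \<and> pure_state n (\<psi> X0) \<and> pure_state n (\<psi> X1) \<and>
    cmod (\<psi> X1 \<bullet>c \<psi> X0) = \<tau>"
  define z where "z = \<psi> X1 \<bullet>c \<psi> X0"
  have pure: "pure_state n (\<psi> l)" for l using asm by (cases l) auto
  then have carr: "\<psi> l \<in> carrier_vec n" and norm: "\<psi> l \<bullet>c \<psi> l = 1" for l
    by (auto simp: pure_state_def)
  \<comment> \<open>Only the second state is rotated, by the conjugate phase of the overlap.\<close>
  define \<phi> where "\<phi> l = (case l of X0 \<Rightarrow> 1 | X1 \<Rightarrow> cnj z / complex_of_real \<tau>)" for l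
  have mod: "cmod (\<phi> l) = 1" for l
    using asm by (auto simp: \<phi>_def z_def norm_divide split: label.split)
  have unit: "\<phi> l * cnj (\<phi> l) = 1" for l
    using complex_norm_square[of "\<phi> l"] mod by simp
  have "cnj z * z = complex_of_real (\<tau>\<^sup>2)"
    using asm complex_norm_square[of z] by (simp add: z_def mult.commute)
  then have ph: "\<phi> X1 * z = complex_of_real \<tau>"
    using asm by (simp add: \<phi>_def power2_eq_square)
  define \<psi>' where "\<psi>' l = \<phi> l \<cdot>\<^sub>v \<psi> l" for l
  interpret comparison_game n \<psi>' \<tau>
  proof
    fix l
    show "\<psi>' l \<in> carrier_vec n" using carr by (simp add: \<psi>'_def)
    show "\<psi>' l \<bullet>c \<psi>' l = 1"
      using carr norm unit by (simp add: \<psi>'_def cscalar_prod_simps[where d = n] mult_ac)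
    show "\<psi>' X1 \<bullet>c \<psi>' X0 = complex_of_real \<tau>"
      using carr ph by (simp add: \<psi>'_def cscalar_prod_simps[where d = n] z_def \<phi>_def)
  qed (use asm in auto)
  define c where "c = 2 * (1 + 1 / \<tau>)"
  \<comment> \<open>Agreement on strategies suffices, as both optima are taken over images of sets
    of strategies.\<close>
  have eq: "expected_payoff c \<psi>' E = expected_payoff c \<psi> E" if "strategy n E" for E
    unfolding \<psi>'_def using expected_payoff_phase[OF that carr mod] .
  then have "p_max n c \<psi>' = p_max n c \<psi>"
    unfolding p_max_def by (simp cong: image_cong_simp)
  moreover have "p_sep n c \<psi>' = p_sep n c \<psi>"
    unfolding p_sep_def using eq by (simp add: separable_strategy_def cong: image_cong_simp)
  moreover have "c > 0" using asm by (simp add: c_def add_pos_pos)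
  ultimately show "\<exists>c>0. p_sep n c \<psi> \<le> p_max n c \<psi> - \<tau>\<^sup>2 * (1 - \<tau>)"
    using p_sep_gap[OF c_def] by auto
qed

end
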